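(* The out-degree $N_{\mathrm{out}}$ of a typical node in the Poisson $i\mathcal{S}$-graph with legitimate-node density $\lambda_\ell>0$ and eavesdropper density $\lambda_{\mathrm e}>0$ (secrecy rate threshold zero, path loss only, equal noise powers) has the geometric probability mass function $$p_{N_{\mathrm{out}}}(n)=\left(\frac{\lambda_\ell}{\lambda_\ell+\lambda_{\mathrm e}}\right)^{n}\left(\frac{\lambda_{\mathrm e}}{\lambda_\ell+\lambda_{\mathrm e}}\right),\qquad n\ge 0.$$
   Context: Poisson $i\mathcal{S}$-graph (zero threshold, path loss only, equal noise powers): $\Pi_\ell$ (legitimate nodes) and $\Pi_{\mathrm e}$ (eavesdroppers) are mutually independent homogeneous Poisson point processes on $\mathbb{R}^2$ with densities $\lambda_\ell>0$ and $\lambda_{\mathrm e}>0$. There is a directed edge $\overrightarrow{xy}$ between distinct legitimate nodes $x,y$ if and only if the maximum secrecy rate of the link is positive, which in this setting is equivalent to $|x-y|<\min_{e\in\Pi_{\mathrm e}}|x-e|$. Typical node: the node at the origin when the graph is built on the legitimate-node set $\Pi_\ell\cup\{0\}$ (Slivnyak's theorem) with eavesdroppers $\Pi_{\mathrm e}$. Its out-degree $N_{\mathrm{out}}$ is the number of $x\in\Pi_\ell$ with an edge $\overrightarrow{0x}$. *)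

theory Defs
  imports "HOL-Probability.Probability" "HOL-Library.Extended_Nat"
begin

section \<open>Poisson point processes\<close>

definition loc_finite :: "'a::metric_space set \<Rightarrow> bool" where
  "loc_finite S \<longleftrightarrow> (\<forall>B. bounded B \<longrightarrow> finite (S \<inter> B))"

text \<open>The measurable space of point configurations: the sigma-algebra on the locally finite
  sets generated by the counting maps of bounded Borel sets. Configurations are sets, which
  loses nothing here, since a homogeneous Poisson process is almost surely simple.\<close>

definition config_space :: "'a::euclidean_space set measure" where
  "config_space = sigma {S. loc_finite S}
     {{S. loc_finite S \<and> card (S \<inter> A) = k} | A k. A \<in> sets borel \<and> bounded A}"

text \<open>The mass function is written out because the library's poisson_pmf requires a positive
  rate, while null sets give rate 0 (with 0 ^ 0 = 1 this is then the point mass at 0). Finite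
  families of disjoint sets are covered by padding the sequence with empty sets.\<close>

definition poisson_process ::
    "'w measure \<Rightarrow> real \<Rightarrow> ('w \<Rightarrow> 'a::euclidean_space set) \<Rightarrow> bool" where
  "poisson_process M d \<Phi> \<longleftrightarrow>
     prob_space M \<and>
     \<Phi> \<in> M \<rightarrow>\<^sub>M config_space \<and>
     (\<forall>A k. A \<in> sets borel \<longrightarrow> bounded A \<longrightarrow>
        measure M {\<omega> \<in> space M. card (\<Phi> \<omega> \<inter> A) = k} =
          (d * measure lborel A) ^ k / fact k * exp (- (d * measure lborel A))) \<and>
     (\<forall>A :: nat \<Rightarrow> 'a set. (\<forall>i. A i \<in> sets borel \<and> bounded (A i)) \<longrightarrow> disjoint_family A \<longrightarrow>
        prob_space.indep_vars M (\<lambda>_. count_space UNIV) (\<lambda>i \<omega>. card (\<Phi> \<omega> \<inter> A i)) UNIV)"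


section \<open>Secrecy rates and the secrecy graph\<close>

text \<open>The channel gain depends on the distance only. Nothing is said about distance 0, so that
  singular gains such as r powr (- 2 * b) are allowed.\<close>

definition path_gain :: "(real \<Rightarrow> real) \<Rightarrow> bool" where
  "path_gain g \<longleftrightarrow> (\<forall>r>0. 0 < g r) \<and> strict_antimono_on {0<..} g"

text \<open>Gaussian channel capacity for transmit power P and noise power N.\<close>

definition capacity ::
    "(real \<Rightarrow> real) \<Rightarrow> real \<Rightarrow> real \<Rightarrow> 'a::metric_space \<Rightarrow> 'a \<Rightarrow> real" where
  "capacity g P N x y = log 2 (1 + P * g (dist x y) / N)"

text \<open>The maximum secrecy rate of the link from x to y: the excess of its capacity over that of
  the strongest eavesdropper in E. The noise power N is the same for all receivers. The
  supremum is a maximum if E is locally finite and nonempty. For empty E it is a fixed but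
  unspecified real number; a Poisson process of positive density is almost surely nonempty.\<close>

definition secrecy_rate ::
    "(real \<Rightarrow> real) \<Rightarrow> real \<Rightarrow> real \<Rightarrow> 'a::metric_space set \<Rightarrow> 'a \<Rightarrow> 'a \<Rightarrow> real" where
  "secrecy_rate g P N E x y = max 0 (capacity g P N x y - (SUP e\<in>E. capacity g P N x e))"

definition secrecy_graph ::
    "(real \<Rightarrow> real) \<Rightarrow> real \<Rightarrow> real \<Rightarrow> 'a::metric_space set \<Rightarrow> 'a set \<Rightarrow> ('a \<times> 'a) set" where
  "secrecy_graph g P N L E =
     {(x, y). x \<in> L \<and> y \<in> L \<and> x \<noteq> y \<and> secrecy_rate g P N E x y > 0}"

definition out_degree :: "('a \<times> 'a) set \<Rightarrow> 'a \<Rightarrow> enat" where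
  "out_degree G x = (if finite (G `` {x}) then enat (card (G `` {x})) else \<infinity>)"

lemma capacity_less_iff:
  assumes "path_gain g" "P > 0" "N > 0" "x \<noteq> y" "x \<noteq> z"
  shows "capacity g P N x z < capacity g P N x y \<longleftrightarrow> dist x y < dist x z"
proof -
  have pos: "0 < dist x y" "0 < dist x z"
    using assms by auto
  then have gpos: "0 < g (dist x y)" "0 < g (dist x z)"
    using assms(1) by (auto simp: path_gain_def)
  have mono: "g s < g r" if "0 < r" "r < s" for r s
    using assms(1) that by (auto simp: path_gain_def monotone_on_def)
  have "g (dist x z) < g (dist x y) \<longleftrightarrow> dist x y < dist x z"
    using mono[of "dist x y" "dist x z"] mono[of "dist x z" "dist x y"] pos
    by (metis less_asym linorder_neq_iff)
  moreover have "0 < 1 + P * g (dist x y) / N" "0 < 1 + P * g (dist x z) / N"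
    using assms gpos by (auto intro!: add_pos_pos divide_pos_pos mult_pos_pos)
  ultimately show ?thesis
    using assms by (simp add: capacity_def divide_strict_right_mono divide_less_cancel)
qed

text \<open>The geometric description of the edges: a positive secrecy rate means that the receiver is
  closer than every eavesdropper.\<close>

lemma secrecy_rate_pos_iff:
  assumes g: "path_gain g" "P > 0" "N > 0" and "x \<noteq> y"
    and E: "loc_finite E" "E \<noteq> {}" "x \<notin> E"
  shows "secrecy_rate g P N E x y > 0 \<longleftrightarrow> dist x y < infdist x E"
proof -
  obtain e1 where e1: "e1 \<in> E"
    using E by auto
  let ?F = "E \<inter> cball x (dist x e1)"
  have "finite ?F"
    using E(1) by (auto simp: loc_finite_def)
  moreover have "?F \<noteq> {}"
    using e1 by auto
  ultimately have "Min (dist x ` ?F) \<in> dist x ` ?F"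
    by (intro Min_in) auto
  then obtain e0 where e0: "e0 \<in> ?F" and Min: "Min (dist x ` ?F) = dist x e0"
    by auto
  have "dist x e0 \<le> dist x e" if "e \<in> ?F" for e
    unfolding Min[symmetric] using that \<open>finite ?F\<close> by (intro Min_le) auto
  then have min: "dist x e0 \<le> dist x e" if "e \<in> E" for e
    using that e0 by (cases "dist x e \<le> dist x e1") auto
  have "infdist x E = dist x e0"
    using e0 min E(2) by (auto simp: infdist_def intro!: cInf_eq_minimum)
  moreover have "(SUP e\<in>E. capacity g P N x e) = capacity g P N x e0"
  proof (rule cSup_eq_maximum)
    fix c assume "c \<in> capacity g P N x ` E"
    then obtain e where "e \<in> E" "c = capacity g P N x e"
      by auto
    moreover from this have "\<not> dist x e < dist x e0"
      using min by (auto simp: not_less)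
    moreover have "x \<noteq> e" "x \<noteq> e0"
      using \<open>e \<in> E\<close> e0 E(3) by auto
    ultimately show "c \<le> capacity g P N x e0"
      using capacity_less_iff[OF g, of x e e0] by auto
  qed (use e0 in auto)
  moreover have "x \<noteq> e0"
    using e0 E(3) by auto
  ultimately show ?thesis
    using capacity_less_iff[OF g, of x y e0] \<open>x \<noteq> y\<close> by (auto simp: secrecy_rate_def)
qed

end

theory Submission
  imports Defs "HOL-Real_Asymp.Real_Asymp"
begin

text \<open>If \<^term>\<open>R\<close> is the distance from the origin to the nearest eavesdropper, the out-degree is
  almost surely the number of legitimate nodes in the ball of radius \<^term>\<open>R\<close>. By the void
  probabilities the volume of this ball is exponentially distributed with rate \<open>d\<^sub>e\<close>, and
  given the volume \<open>t\<close> the count is Poisson with mean \<open>d\<^sub>l * t\<close>. Integrating the Poisson mass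
  function against the exponential density gives the geometric distribution.\<close>

section \<open>Locally finite configurations\<close>

text \<open>Only finitely many points of \<open>E\<close> are as close to \<open>x\<close> as a
  chosen one, and the rest are farther, so a minimum over these few is a minimum over
  \<open>E\<close>.\<close>

lemma loc_finite_ex_nearest:
  assumes "loc_finite E" "E \<noteq> {}"
  shows "\<exists>e\<in>E. \<forall>e'\<in>E. dist x e \<le> dist x e'"
proof -
  obtain e1 where e1: "e1 \<in> E"
    using assms by auto
  let ?F = "E \<inter> cball x (dist x e1)"
  have "finite ?F"
    using assms(1) by (auto simp: loc_finite_def)
  moreover have "?F \<noteq> {}"
    using e1 by auto
  ultimately obtain e where "is_arg_min (dist x) (\<lambda>e. e \<in> ?F) e"
    using ex_is_arg_min_if_finite[of ?F "dist x"] by blast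
  then have e: "e \<in> ?F" "\<And>e'. e' \<in> ?F \<Longrightarrow> dist x e \<le> dist x e'"
    by (simp_all add: is_arg_min_linorder)
  then have "dist x e \<le> dist x e'" if "e' \<in> E" for e'
    using that e(1) by (cases "dist x e' \<le> dist x e1") auto
  then show ?thesis
    using e by blast
qed

lemma loc_finite_subset: "loc_finite S \<Longrightarrow> T \<subseteq> S \<Longrightarrow> loc_finite T"
  unfolding loc_finite_def by (meson Int_mono finite_subset order_refl)

lemma loc_finite_infdist_eq:
  assumes "loc_finite E" "E \<noteq> {}"
  shows "\<exists>e\<in>E. infdist x E = dist x e \<and> (\<forall>e'\<in>E. dist x e \<le> dist x e')"
proof -
  obtain e where e: "e \<in> E" "\<And>e'. e' \<in> E \<Longrightarrow> dist x e \<le> dist x e'"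
    using loc_finite_ex_nearest[OF assms] by blast
  then have "infdist x E = dist x e"
    using assms(2) by (auto simp: infdist_def intro!: cInf_eq_minimum)
  with e show ?thesis
    by blast
qed

lemma infdist_le_iff_Int_cball:
  assumes "loc_finite E" "E \<noteq> {}"
  shows "infdist x E \<le> r \<longleftrightarrow> E \<inter> cball x r \<noteq> {}"
proof -
  obtain e where e: "e \<in> E" "infdist x E = dist x e" "\<And>e'. e' \<in> E \<Longrightarrow> dist x e \<le> dist x e'"
    using loc_finite_infdist_eq[OF assms, of x] by blast
  have "dist x e \<le> r" if "e' \<in> E" "dist x e' \<le> r" for e'
    using e(3)[OF that(1)] that(2) by (rule order_trans)
  then show ?thesis
    using e(1,2) by auto
qed

text \<open>Removing \<open>x\<close> from \<open>E\<close> leaves only eavesdroppers at positive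
  distance, the only distances at which \<open>path_gain\<close> says anything. If none is left, all
  of \<open>L\<close> remains.\<close>

definition nearer :: "'a::metric_space \<Rightarrow> 'a set \<Rightarrow> 'a set \<Rightarrow> 'a set" where
  "nearer x L E = {y \<in> L. \<forall>e\<in>E - {x}. dist x y < dist x e}"

lemma nearer_eq_Int_ball:
  assumes "loc_finite E" "E \<noteq> {}" "x \<notin> E"
  shows "nearer x L E = L \<inter> ball x (infdist x E)"
proof -
  obtain e where e: "e \<in> E" "infdist x E = dist x e" "\<And>e'. e' \<in> E \<Longrightarrow> dist x e \<le> dist x e'"
    using loc_finite_infdist_eq[OF assms(1,2), of x] by blast
  have "dist x y < dist x e'" if "dist x y < dist x e" "e' \<in> E" for y e'
    using that e(3) less_le_trans by blast
  then show ?thesis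
    using e(1,2) assms(3) by (auto simp: nearer_def)
qed

text \<open>This prepares measurability: a rational radius separates the distances of finitely many
  chosen points from those of the points of \<open>E\<close>, so countably many counts decide the
  left-hand side. Finite subsets are used because \<open>card\<close> of an infinite set is
  0.\<close>

lemma nearer_card_ge_iff:
  assumes L: "loc_finite L" and E: "loc_finite E"
  shows "(\<exists>F\<subseteq>nearer x L E. finite F \<and> card F = k) \<longleftrightarrow>
    (\<exists>q\<in>\<rat>. k \<le> card (L \<inter> ball x q) \<and> card (E \<inter> (ball x q - {x})) = 0)" (is "?lhs \<longleftrightarrow> ?rhs")
proof
  assume ?lhs
  then obtain F where F: "F \<subseteq> nearer x L E" "finite F" "card F = k"
    by blast
  show ?rhs
  proof (cases "F = {}")
    case True
    \<comment> \<open>Here \<open>k = 0\<close>, and the empty ball of radius 0 meets both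
      conditions.\<close>
    then show ?thesis
      using F by (intro bexI[of _ 0]) auto
  next
    case False
    define m where "m = Max (dist x ` F)"
    have "m \<in> dist x ` F"
      unfolding m_def using F False by (intro Max_in) auto
    then have m: "m < dist x e" if "e \<in> E - {x}" for e
      using F(1) that by (auto simp: nearer_def)
    have le_m: "dist x y \<le> m" if "y \<in> F" for y
      unfolding m_def using F that by (intro Max_ge) auto
    \<comment> \<open>The cutoff \<open>m + 1\<close> leaves finitely many competitors, so a minimum
      exists; including \<open>m + 1\<close> in it covers an empty \<open>W\<close> and keeps
      \<open>u\<close> below the distances of the points outside \<open>W\<close>.\<close>
    define W where "W = (E - {x}) \<inter> cball x (m + 1)"
    have W: "finite W"
      using E by (auto simp: W_def loc_finite_def intro: finite_subset[of _ "E \<inter> cball x (m + 1)"])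
    define u where "u = Min (insert (m + 1) (dist x ` W))"
    have "m < u"
      unfolding u_def using W m by (subst Min_gr_iff) (auto simp: W_def)
    then obtain q where q: "q \<in> \<rat>" "m < q" "q < u"
      using Rats_dense_in_real by blast
    have "u \<le> dist x e" if "e \<in> E - {x}" for e
    proof (cases "e \<in> W")
      case True
      then show ?thesis
        unfolding u_def using W by (intro Min_le) auto
    next
      case False
      moreover have "u \<le> m + 1"
        unfolding u_def using W by (intro Min_le) auto
      ultimately show ?thesis
        using that by (auto simp: W_def)
    qed
    then have "E \<inter> (ball x q - {x}) = {}"
      using q by fastforce
    moreover have "k \<le> card (L \<inter> ball x q)"
      unfolding F(3)[symmetric]
    proof (rule card_mono)
      show "finite (L \<inter> ball x q)"
        using L by (auto simp: loc_finite_def)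
      show "F \<subseteq> L \<inter> ball x q"
        using F(1) le_m q by (fastforce simp: nearer_def)
    qed
    ultimately show ?thesis
      using q by (intro bexI[of _ q]) auto
  qed
next
  assume ?rhs
  then obtain q where q: "k \<le> card (L \<inter> ball x q)" "card (E \<inter> (ball x q - {x})) = 0"
    by blast
  have "finite (E \<inter> ball x q)"
    using E by (auto simp: loc_finite_def)
  then have "finite (E \<inter> (ball x q - {x}))"
    by (rule finite_subset[rotated]) auto
  with q have "E \<inter> (ball x q - {x}) = {}"
    by simp
  then have "L \<inter> ball x q \<subseteq> nearer x L E"
    by (fastforce simp: nearer_def)
  moreover obtain F where "F \<subseteq> L \<inter> ball x q" "card F = k" "finite F"
    using obtain_subset_with_card_n[OF q(1)] by blast
  ultimately show ?lhs
    by blast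
qed

text \<open>An infinite set has finite subsets of every size, so it fails the second condition. The
  event of exactly \<open>n\<close> points thus becomes a difference of two events of the form at
  least \<open>k\<close> points.\<close>

lemma finite_card_eq_iff:
  "finite V \<and> card V = n \<longleftrightarrow>
    (\<exists>F\<subseteq>V. finite F \<and> card F = n) \<and> \<not> (\<exists>F\<subseteq>V. finite F \<and> card F = Suc n)" (is "?lhs \<longleftrightarrow> ?rhs")
proof
  assume V: ?lhs
  then have "card F \<noteq> Suc n" if "F \<subseteq> V" for F
    using card_mono[of V F] that by auto
  with V show ?rhs
    by blast
next
  assume rhs: ?rhs
  then obtain F where F: "F \<subseteq> V" "finite F" "card F = n"
    by blast
  have "V \<subseteq> F"
  proof
    fix y assume "y \<in> V"
    show "y \<in> F"
    proof (rule ccontr)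
      assume "y \<notin> F"
      then have "insert y F \<subseteq> V" "finite (insert y F)" "card (insert y F) = Suc n"
        using F \<open>y \<in> V\<close> by auto
      with rhs show False
        by blast
    qed
  qed
  with F show ?lhs
    by (metis subset_antisym)
qed


section \<open>Measurability\<close>

lemma space_config_space: "space config_space = {S. loc_finite S}"
  unfolding config_space_def by (rule space_measure_of) auto

lemma config_space_count_sets:
  assumes "A \<in> sets borel" "bounded A"
  shows "{S. loc_finite S \<and> card (S \<inter> A) = k} \<in> sets config_space"
  unfolding config_space_def using assms by (subst sets_measure_of) auto

lemma measurable_config_count:
  assumes [measurable]: "X \<in> M \<rightarrow>\<^sub>M config_space" and "A \<in> sets borel" "bounded A"
  shows "(\<lambda>\<omega>. card (X \<omega> \<inter> A)) \<in> M \<rightarrow>\<^sub>M count_space UNIV"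
proof (rule measurable_compose[OF assms(1)])
  show "(\<lambda>S. card (S \<inter> A)) \<in> config_space \<rightarrow>\<^sub>M count_space UNIV"
    using config_space_count_sets[OF assms(2,3)]
    by (auto simp: measurable_count_space_eq2_countable vimage_def space_config_space Int_def
        conj_commute)
qed

lemma measurable_config_space_iff:
  "X \<in> M \<rightarrow>\<^sub>M config_space \<longleftrightarrow> (\<forall>\<omega>\<in>space M. loc_finite (X \<omega>)) \<and>
    (\<forall>A k. A \<in> sets borel \<longrightarrow> bounded A \<longrightarrow> {\<omega>\<in>space M. card (X \<omega> \<inter> A) = k} \<in> sets M)"
    (is "_ \<longleftrightarrow> ?rhs")
proof
  assume X: "X \<in> M \<rightarrow>\<^sub>M config_space"
  have "{\<omega>\<in>space M. card (X \<omega> \<inter> A) = k} \<in> sets M" if "A \<in> sets borel" "bounded A" for A k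
  proof -
    note [measurable] = measurable_config_count[OF X that]
    show ?thesis
      by measurable
  qed
  moreover have "loc_finite (X \<omega>)" if "\<omega> \<in> space M" for \<omega>
    using measurable_space[OF X that] by (simp add: space_config_space)
  ultimately show ?rhs
    by blast
next
  assume R: ?rhs
  show "X \<in> M \<rightarrow>\<^sub>M config_space"
    unfolding config_space_def
  proof (rule measurable_measure_of)
    fix B :: "'b set set"
    assume "B \<in> {{S. loc_finite S \<and> card (S \<inter> A) = k} | A k. A \<in> sets borel \<and> bounded A}"
    then obtain A k where A: "A \<in> sets borel" "bounded A" "B = {S. loc_finite S \<and> card (S \<inter> A) = k}"
      by blast
    then have "X -` B \<inter> space M = {\<omega>\<in>space M. card (X \<omega> \<inter> A) = k}"
      using R by auto
    then show "X -` B \<inter> space M \<in> sets M"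
      using R A by auto
  qed (use R in auto)
qed

text \<open>\<open>B\<close> may be unbounded: the count in \<open>A\<close> becomes the original
  count in \<open>B \<inter> A\<close>, which is bounded because \<open>A\<close> is.\<close>

lemma measurable_config_Int:
  assumes "X \<in> M \<rightarrow>\<^sub>M config_space" "B \<in> sets borel"
  shows "(\<lambda>\<omega>. X \<omega> \<inter> B) \<in> M \<rightarrow>\<^sub>M config_space"
  unfolding measurable_config_space_iff
proof (intro conjI ballI allI impI)
  fix \<omega> assume "\<omega> \<in> space M"
  then have "loc_finite (X \<omega>)"
    using assms(1) by (simp add: measurable_config_space_iff)
  then show "loc_finite (X \<omega> \<inter> B)"
    by (rule loc_finite_subset) simp
next
  fix A :: "'b set" and k assume "A \<in> sets borel" "bounded A"
  then have "B \<inter> A \<in> sets borel" "bounded (B \<inter> A)"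
    using assms(2) by (auto intro: bounded_subset)
  then show "{\<omega>\<in>space M. card (X \<omega> \<inter> B \<inter> A) = k} \<in> sets M"
    using assms(1) by (simp add: measurable_config_space_iff Int_assoc)
qed

text \<open>The whole space is not bounded, so its count is not a generator; emptiness is tested on
  the countably many balls of integer radius.\<close>

lemma sets_config_empty:
  assumes X: "X \<in> M \<rightarrow>\<^sub>M config_space"
  shows "{\<omega>\<in>space M. X \<omega> = {}} \<in> sets M"
proof -
  have "X \<omega> = {} \<longleftrightarrow> (\<forall>n::nat. card (X \<omega> \<inter> ball 0 (real n)) = 0)" if "\<omega> \<in> space M" for \<omega>
  proof -
    have "finite (X \<omega> \<inter> ball 0 (real n))" for n
      using measurable_space[OF X that] by (auto simp: space_config_space loc_finite_def)
    moreover have "X \<omega> = {} \<longleftrightarrow> (\<forall>n::nat. X \<omega> \<inter> ball 0 (real n) = {})"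
      using reals_Archimedean2 by (force simp: disjoint_iff)
    ultimately show ?thesis
      by simp
  qed
  then have eq: "{\<omega>\<in>space M. X \<omega> = {}} = {\<omega>\<in>space M. \<forall>n::nat. card (X \<omega> \<inter> ball 0 (real n)) = 0}"
    by blast
  have [measurable]: "(\<lambda>\<omega>. card (X \<omega> \<inter> ball 0 (real n))) \<in> M \<rightarrow>\<^sub>M count_space UNIV" for n
    by (rule measurable_config_count[OF X]) auto
  show ?thesis
    unfolding eq by measurable
qed

lemma measurable_infdist_config:
  assumes X: "X \<in> M \<rightarrow>\<^sub>M config_space"
  shows "(\<lambda>\<omega>. infdist x (X \<omega>)) \<in> borel_measurable M"
  unfolding borel_measurable_iff_le
proof
  fix r
  have [measurable]: "{\<omega>\<in>space M. X \<omega> = {}} \<in> sets M"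
    by (rule sets_config_empty[OF X])
  have [measurable]: "(\<lambda>\<omega>. card (X \<omega> \<inter> cball x r)) \<in> M \<rightarrow>\<^sub>M count_space UNIV"
    by (rule measurable_config_count[OF X]) auto
  \<comment> \<open>\<open>infdist\<close> to the empty set is 0 by definition, whence the separate
    branch.\<close>
  have "infdist x (X \<omega>) \<le> r \<longleftrightarrow>
      (if X \<omega> = {} then 0 \<le> r else card (X \<omega> \<inter> cball x r) \<noteq> 0)" if "\<omega> \<in> space M" for \<omega>
  proof -
    have L: "loc_finite (X \<omega>)"
      using measurable_space[OF X that] by (simp add: space_config_space)
    then have "finite (X \<omega> \<inter> cball x r)"
      by (simp add: loc_finite_def)
    then show ?thesis
      using infdist_le_iff_Int_cball[OF L] by (auto simp: infdist_def)
  qed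
  then have "{\<omega>\<in>space M. infdist x (X \<omega>) \<le> r} =
      {\<omega>\<in>space M. if X \<omega> = {} then 0 \<le> r else card (X \<omega> \<inter> cball x r) \<noteq> 0}"
    by blast
  also have "\<dots> \<in> sets M"
    by measurable
  finally show "{\<omega>\<in>space M. infdist x (X \<omega>) \<le> r} \<in> sets M" .
qed

text \<open>The rational radii turn having at least \<open>k\<close> points into a countable union
  of counting events; having exactly \<open>n\<close> is then a difference.\<close>

lemma sets_nearer_card:
  assumes X: "X \<in> M \<rightarrow>\<^sub>M config_space" and Y: "Y \<in> M \<rightarrow>\<^sub>M config_space"
  shows "{\<omega>\<in>space M. finite (nearer x (X \<omega>) (Y \<omega>)) \<and> card (nearer x (X \<omega>) (Y \<omega>)) = n} \<in> sets M"
proof -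
  have [measurable]: "(\<lambda>\<omega>. card (X \<omega> \<inter> ball x q)) \<in> M \<rightarrow>\<^sub>M count_space UNIV" for q
    by (rule measurable_config_count[OF X]) auto
  have [measurable]: "(\<lambda>\<omega>. card (Y \<omega> \<inter> (ball x q - {x}))) \<in> M \<rightarrow>\<^sub>M count_space UNIV" for q
    by (rule measurable_config_count[OF Y]) (auto intro: bounded_subset[of "ball x q"])
  have *: "{\<omega>\<in>space M. \<exists>F\<subseteq>nearer x (X \<omega>) (Y \<omega>). finite F \<and> card F = k} \<in> sets M" for k
  proof -
    have "{\<omega>\<in>space M. \<exists>F\<subseteq>nearer x (X \<omega>) (Y \<omega>). finite F \<and> card F = k} =
      {\<omega>\<in>space M. \<exists>q\<in>\<rat>. k \<le> card (X \<omega> \<inter> ball x q) \<and> card (Y \<omega> \<inter> (ball x q - {x})) = 0}"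
      using measurable_space[OF X] measurable_space[OF Y]
      by (intro Collect_cong conj_cong refl nearer_card_ge_iff) (auto simp: space_config_space)
    also have "\<dots> = (\<Union>q\<in>\<rat>. {\<omega>\<in>space M. k \<le> card (X \<omega> \<inter> ball x q) \<and>
        card (Y \<omega> \<inter> (ball x q - {x})) = 0})"
      by blast
    also have "\<dots> \<in> sets M"
      by (intro sets.countable_UN'' countable_rat) measurable
    finally show ?thesis .
  qed
  have "{\<omega>\<in>space M. finite (nearer x (X \<omega>) (Y \<omega>)) \<and> card (nearer x (X \<omega>) (Y \<omega>)) = n} =
      {\<omega>\<in>space M. \<exists>F\<subseteq>nearer x (X \<omega>) (Y \<omega>). finite F \<and> card F = n} -
      {\<omega>\<in>space M. \<exists>F\<subseteq>nearer x (X \<omega>) (Y \<omega>). finite F \<and> card F = Suc n}"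
    using finite_card_eq_iff[of "nearer x (X \<omega>) (Y \<omega>)" n for \<omega>] by blast
  then show ?thesis
    using *[of n] *[of "Suc n"] by simp
qed


section \<open>Poisson processes\<close>

lemma measure_lborel_cball:
  "measure lborel (cball x r) = measure lborel (ball (x :: 'a::euclidean_space) r)"
  by (cases "0 \<le> r") (simp_all add: content_ball content_cball)

lemma ex_ball_volume:
  assumes "0 \<le> a"
  obtains r where "0 \<le> r" "measure lborel (ball (x :: 'a::euclidean_space) r) = a"
proof -
  let ?v = "unit_ball_vol (DIM('a))"
  let ?r = "root DIM('a) (a / ?v)"
  have v: "0 < ?v"
    by simp
  have r: "0 \<le> ?r" "?r ^ DIM('a) = a / ?v"
    using assms v by (auto simp: real_root_pow_pos2)
  have "measure lborel (ball x ?r) = ?v * (a / ?v)"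
    using r by (simp only: content_ball)
  also have "\<dots> = a"
    using v less_imp_neq[OF v] by (metis nonzero_mult_div_cancel_left times_divide_eq_right)
  finally show ?thesis
    using that r(1) by blast
qed

lemma ball_volume_le_iff:
  assumes "0 \<le> r" "0 \<le> s"
  shows "measure lborel (ball (x :: 'a::euclidean_space) r) \<le> measure lborel (ball x s) \<longleftrightarrow> r \<le> s"
proof -
  have "0 < unit_ball_vol (DIM('a))"
    by simp
  then show ?thesis
    using assms by (simp add: content_ball mult_le_cancel_left_pos power_mono_iff)
qed

section \<open>Void probabilities and the nearest point\<close>

lemma (in prob_space) poisson_process_void:
  assumes "poisson_process M d \<Phi>" "A \<in> sets borel" "bounded A"
  shows "prob {\<omega>\<in>space M. \<Phi> \<omega> \<inter> A = {}} = exp (- (d * measure lborel A))"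
proof -
  \<comment> \<open>Local finiteness excludes infinite intersections, whose \<open>card\<close>
    would also be 0; emptiness is then the case \<open>k = 0\<close> of the mass function.\<close>
  have "finite (\<Phi> \<omega> \<inter> A)" if "\<omega> \<in> space M" for \<omega>
    using measurable_space[of \<Phi> M config_space \<omega>] assms that
    by (auto simp: poisson_process_def space_config_space loc_finite_def)
  then have "{\<omega>\<in>space M. \<Phi> \<omega> \<inter> A = {}} = {\<omega>\<in>space M. card (\<Phi> \<omega> \<inter> A) = 0}"
    by auto
  then show ?thesis
    using assms by (simp add: poisson_process_def)
qed

text \<open>A point is a null set, so its void probability is \<open>exp 0 = 1\<close>.\<close>

lemma (in prob_space) poisson_process_AE_notin:
  assumes "poisson_process M d \<Phi>"
  shows "AE \<omega> in M. x \<notin> \<Phi> \<omega>"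
proof -
  let ?A = "{\<omega>\<in>space M. \<Phi> \<omega> \<inter> {x} = {}}"
  have 1: "prob ?A = 1"
    using poisson_process_void[OF assms, of "{x}"] by simp
  \<comment> \<open>\<open>measure\<close> is 0 on non-measurable sets, so a nonzero value certifies
    that \<open>?A\<close> is an event.\<close>
  then have "?A \<in> events"
    using measure_notin_sets[of ?A M] zero_neq_one by metis
  with 1 have "AE \<omega> in M. \<omega> \<in> ?A"
    by (simp only: prob_eq_1)
  then show ?thesis
    by eventually_elim auto
qed

text \<open>An empty configuration misses balls of every volume \<open>a\<close>, so its probability
  is at most \<open>exp (- (d * a))\<close> for all \<open>a \<ge> 0\<close>, which tends to
  0.\<close>

lemma (in prob_space) poisson_process_AE_nonempty:
  assumes P: "poisson_process M d \<Phi>" and "d > 0"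
  shows "AE \<omega> in M. \<Phi> \<omega> \<noteq> {}"
proof -
  let ?E = "{\<omega>\<in>space M. \<Phi> \<omega> = {}}"
  have X: "\<Phi> \<in> M \<rightarrow>\<^sub>M config_space"
    using P by (simp add: poisson_process_def)
  have [measurable]: "?E \<in> events"
    by (rule sets_config_empty[OF X])
  have bound: "prob ?E \<le> exp (- (d * a))" if a: "0 \<le> a" for a
  proof -
    obtain r where r: "0 \<le> r" "measure lborel (ball (0 :: 'b) r) = a"
      using ex_ball_volume[OF a] by blast
    have "prob ?E \<le> prob {\<omega>\<in>space M. \<Phi> \<omega> \<inter> ball 0 r = {}}"
    proof (rule finite_measure_mono)
      have "prob {\<omega>\<in>space M. \<Phi> \<omega> \<inter> ball 0 r = {}} \<noteq> 0"
        using poisson_process_void[OF P, of "ball 0 r"] by simp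
      then show "{\<omega>\<in>space M. \<Phi> \<omega> \<inter> ball 0 r = {}} \<in> events"
        using measure_notin_sets by blast
    qed auto
    then show ?thesis
      using poisson_process_void[OF P, of "ball 0 r"] r by simp
  qed
  have "((\<lambda>a. exp (- (d * a))) \<longlongrightarrow> 0) at_top"
    using \<open>d > 0\<close> by real_asymp
  then have "prob ?E \<le> 0"
    by (rule tendsto_lowerbound) (auto intro!: eventually_mono[OF eventually_ge_at_top[of 0]] bound)
  then have "prob ?E = 0"
    using measure_nonneg[of M ?E] by linarith
  then show ?thesis
    by (subst AE_iff_measurable[OF _ refl]) (auto simp: emeasure_eq_measure)
qed

text \<open>Almost surely the volume exceeds \<open>a\<close> exactly when the closed ball of volume
  \<open>a\<close> about \<open>x\<close> is void, so its tail is \<open>exp (- (d * a))\<close>.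
  Measuring by volume instead of radius makes the law exponential in every dimension.\<close>

lemma (in prob_space) poisson_process_nearest_volume:
  fixes \<Phi> :: "'a \<Rightarrow> 'b::euclidean_space set"
  assumes P: "poisson_process M d \<Phi>" and d: "d > 0"
  shows "distributed M lborel (\<lambda>\<omega>. measure lborel (ball x (infdist x (\<Phi> \<omega>))))
    (exponential_density d)"
proof (rule exponential_distributedI)
  have X: "\<Phi> \<in> M \<rightarrow>\<^sub>M config_space"
    using P by (simp add: poisson_process_def)
  note [measurable] = measurable_infdist_config[OF X, of x]
  have vol: "measure lborel (ball x (infdist x (\<Phi> \<omega>))) =
      unit_ball_vol (DIM('b)) * infdist x (\<Phi> \<omega>) ^ DIM('b)" for \<omega>
    by (simp add: content_ball infdist_nonneg)
  show V: "(\<lambda>\<omega>. measure lborel (ball x (infdist x (\<Phi> \<omega>)))) \<in> borel_measurable M"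
    unfolding vol by measurable
  fix a :: real assume "0 \<le> a"
  then obtain r where r: "0 \<le> r" "measure lborel (ball x r) = a"
    using ex_ball_volume by blast
  let ?A = "{\<omega>\<in>space M. \<Phi> \<omega> \<inter> cball x r = {}}"
  have A: "prob ?A = exp (- (d * a))"
    using poisson_process_void[OF P, of "cball x r"] r by (simp add: measure_lborel_cball)
  then have [measurable]: "?A \<in> events"
    using measure_notin_sets by force
  have "prob {\<omega>\<in>space M. measure lborel (ball x (infdist x (\<Phi> \<omega>))) \<le> a} = prob (space M - ?A)"
  proof (rule finite_measure_eq_AE)
    \<comment> \<open>Nonemptiness matters, as an empty configuration would give distance 0. Volumes
      are compared through their radii.\<close>
    show "AE \<omega> in M. \<omega> \<in> {\<omega>\<in>space M. measure lborel (ball x (infdist x (\<Phi> \<omega>))) \<le> a} \<longleftrightarrow>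
        \<omega> \<in> space M - ?A"
      using poisson_process_AE_nonempty[OF P d] AE_space
    proof eventually_elim
      case (elim \<omega>)
      have "loc_finite (\<Phi> \<omega>)"
        using measurable_space[OF X] elim by (simp add: space_config_space)
      with elim r show ?case
        by (simp add: ball_volume_le_iff infdist_nonneg infdist_le_iff_Int_cball flip: r(2))
    qed
  qed (use V in measurable)
  also have "\<dots> = 1 - exp (- (d * a))"
    using A by (simp add: prob_compl)
  finally show "emeasure M {\<omega>\<in>space M. measure lborel (ball x (infdist x (\<Phi> \<omega>))) \<le> a} =
      1 - ennreal (exp (- a * d))"
    by (simp add: emeasure_eq_measure mult.commute ennreal_minus flip: ennreal_1)
qed (fact d)

text \<open>A Poisson count whose mean is exponentially distributed is geometric: the product of the
  two densities is a multiple of an Erlang density.\<close>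

lemma nn_integral_poisson_exponential:
  assumes "a > 0" "b > 0"
  shows "(\<integral>\<^sup>+t. exponential_density b t * ((a * t) ^ n / fact n * exp (- (a * t))) \<partial>lborel) =
    ennreal ((a / (a + b)) ^ n * (b / (a + b)))"
proof -
  let ?c = "(a / (a + b)) ^ n * (b / (a + b))"
  have c: "0 \<le> ?c"
    using assms by simp
  have "exponential_density b t * ((a * t) ^ n / fact n * exp (- (a * t))) =
      ?c * erlang_density n (a + b) t" for t
  proof -
    have "exp (- (t * b)) * exp (- (a * t)) = exp (- (a + b) * t)"
      by (simp add: algebra_simps flip: exp_add)
    then have "exponential_density b t * ((a * t) ^ n / fact n * exp (- (a * t))) =
        (if t < 0 then 0 else (a ^ n * b) * (t ^ n * exp (- (a + b) * t) / fact n))"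
      by (simp add: exponential_density_def power_mult_distrib mult_ac)
    \<comment> \<open>The factor \<open>(a + b) ^ Suc n\<close> is the normalisation of the Erlang
      density with rate \<open>a + b\<close>; what remains is the geometric probability.\<close>
    also have "a ^ n * b = ?c * (a + b) ^ Suc n"
      using assms by (simp add: power_divide)
    also have "(if t < 0 then 0 else ?c * (a + b) ^ Suc n * (t ^ n * exp (- (a + b) * t) / fact n)) =
        ?c * erlang_density n (a + b) t"
      by (cases "t < 0")
        (simp_all only: erlang_density_def if_True if_False mult_zero_right mult.assoc times_divide_eq_right)
    finally show ?thesis .
  qed
  then have "(\<integral>\<^sup>+t. exponential_density b t * ((a * t) ^ n / fact n * exp (- (a * t))) \<partial>lborel) =
      (\<integral>\<^sup>+t. ennreal ?c * ennreal (erlang_density n (a + b) t) \<partial>lborel)"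
    by (simp only: ennreal_mult'[OF c])
  \<comment> \<open>The moment of order 0 is the total mass of the density, which is 1.\<close>
  also have "\<dots> = ennreal ?c"
    using nn_integral_erlang_ith_moment[of "a + b" n 0] assms by (subst nn_integral_cmult) auto
  finally show ?thesis .
qed

text \<open>By independence the joint law is a product, so Fubini allows the eavesdroppers to be
  fixed first. The count is then that of a Poisson process in a deterministic ball, and what remains
  is an average over the volume of that ball.\<close>

lemma (in prob_space) poisson_nearer_distribution:
  fixes L E :: "'a \<Rightarrow> 'b::euclidean_space set"
  assumes a: "a > 0" and b: "b > 0"
    and L: "poisson_process M a L" and E: "poisson_process M b E"
    and indep: "indep_var config_space L config_space E"
  shows "prob {\<omega>\<in>space M. finite (nearer x (L \<omega>) (E \<omega>)) \<and> card (nearer x (L \<omega>) (E \<omega>)) = n} =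
    (a / (a + b)) ^ n * (b / (a + b))"
proof -
  have mL[measurable]: "L \<in> M \<rightarrow>\<^sub>M config_space" and mE[measurable]: "E \<in> M \<rightarrow>\<^sub>M config_space"
    using L E by (auto simp: poisson_process_def)
  let ?DE = "distr M config_space E" and ?DL = "distr M config_space L"
  let ?vol = "\<lambda>r. measure lborel (ball x r)"
  define p where "p t = (a * t) ^ n / fact n * exp (- (a * t))" for t
  have [measurable]: "p \<in> borel_measurable borel"
    unfolding p_def by measurable
  interpret DL: prob_space ?DL
    by (rule prob_space_distr) measurable
  interpret DE: prob_space ?DE
    by (rule prob_space_distr) measurable
  interpret pair_sigma_finite ?DL ?DE ..
  define A where "A = {w \<in> space (config_space \<Otimes>\<^sub>M config_space).
    finite (nearer x (fst w) (snd w)) \<and> card (nearer x (fst w) (snd w)) = n}"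
  have A[measurable]: "A \<in> sets (config_space \<Otimes>\<^sub>M config_space)"
    unfolding A_def by (rule sets_nearer_card) measurable
  have pair: "(\<lambda>\<omega>. (L \<omega>, E \<omega>)) \<in> M \<rightarrow>\<^sub>M config_space \<Otimes>\<^sub>M config_space"
    by measurable
  have joint: "?DL \<Otimes>\<^sub>M ?DE = distr M (config_space \<Otimes>\<^sub>M config_space) (\<lambda>\<omega>. (L \<omega>, E \<omega>))"
    using indep by (simp add: indep_var_distribution_eq)
  have slice: "emeasure ?DL ((\<lambda>K. (K, S)) -` A) = p (?vol (infdist x S))"
    if S: "loc_finite S" "S \<noteq> {}" "x \<notin> S" for S
  proof -
    have "(\<lambda>K. (K, S)) -` A \<in> sets config_space"
      using A by (rule sets_Pair2)
    then have "emeasure ?DL ((\<lambda>K. (K, S)) -` A) = emeasure M (L -` ((\<lambda>K. (K, S)) -` A) \<inter> space M)"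
      by (simp add: emeasure_distr)
    also have "L -` ((\<lambda>K. (K, S)) -` A) \<inter> space M = {\<omega>\<in>space M. card (L \<omega> \<inter> ball x (infdist x S)) = n}"
    proof -
      have "loc_finite (L \<omega>)" if "\<omega> \<in> space M" for \<omega>
        using measurable_space[OF mL that] by (simp add: space_config_space)
      then show ?thesis
        using S by (auto simp: A_def space_pair_measure space_config_space nearer_eq_Int_ball
            loc_finite_def)
    qed
    also have "emeasure M \<dots> = p (?vol (infdist x S))"
      using L by (simp add: emeasure_eq_measure poisson_process_def p_def)
    finally show ?thesis .
  qed
  have "emeasure M {\<omega>\<in>space M. finite (nearer x (L \<omega>) (E \<omega>)) \<and> card (nearer x (L \<omega>) (E \<omega>)) = n} =
      emeasure (distr M (config_space \<Otimes>\<^sub>M config_space) (\<lambda>\<omega>. (L \<omega>, E \<omega>))) A"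
    using measurable_space[OF mL] measurable_space[OF mE]
    by (subst emeasure_distr[OF pair A]) (auto simp: A_def space_pair_measure
        intro!: arg_cong[of _ _ "emeasure M"])
  \<comment> \<open>Fubini, with the eavesdropper coordinate integrated last.\<close>
  also have "\<dots> = (\<integral>\<^sup>+S. emeasure ?DL ((\<lambda>K. (K, S)) -` A) \<partial>?DE)"
    unfolding joint[symmetric] by (rule emeasure_pair_measure_alt2) simp
  also have "\<dots> = (\<integral>\<^sup>+\<omega>. emeasure ?DL ((\<lambda>K. (K, E \<omega>)) -` A) \<partial>M)"
    by (rule nn_integral_distr) (use measurable_emeasure_Pair2[of A] in simp_all)
  \<comment> \<open>\<open>slice\<close> needs a nonempty configuration avoiding \<open>x\<close>,
    which \<open>E\<close> is almost surely.\<close>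
  also have "\<dots> = (\<integral>\<^sup>+\<omega>. p (?vol (infdist x (E \<omega>))) \<partial>M)"
  proof (rule nn_integral_cong_AE)
    show "AE \<omega> in M. emeasure ?DL ((\<lambda>K. (K, E \<omega>)) -` A) = ennreal (p (?vol (infdist x (E \<omega>))))"
      using poisson_process_AE_nonempty[OF E b] poisson_process_AE_notin[OF E, of x] AE_space
    proof eventually_elim
      case (elim \<omega>)
      then show ?case
        using measurable_space[OF mE] by (intro slice) (auto simp: space_config_space)
    qed
  qed
  \<comment> \<open>The integrand depends on \<open>E\<close> only through the volume, whose density
    is exponential.\<close>
  also have "\<dots> = (\<integral>\<^sup>+t. exponential_density b t * p t \<partial>lborel)"
    using b by (subst distributed_nn_integral[OF poisson_process_nearest_volume[OF E b], symmetric])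
      (auto simp: ennreal_mult')
  also have "\<dots> = ennreal ((a / (a + b)) ^ n * (b / (a + b)))"
    unfolding p_def by (rule nn_integral_poisson_exponential[OF a b])
  finally show ?thesis
    using a b by (simp add: emeasure_eq_measure)
qed


section \<open>The out-degree\<close>

lemma out_degree_eq_iff:
  "out_degree G x = enat n \<longleftrightarrow> finite (G `` {x}) \<and> card (G `` {x}) = n"
  by (auto simp: out_degree_def)

text \<open>A strict bound passes to the supremum because the supremum is attained. Among the points
  other than \<open>x\<close> the nearest has the largest capacity; the capacity at \<open>x\<close>
  itself involves the unspecified \<open>g 0\<close> and competes separately.\<close>

lemma Sup_capacity_less_iff:
  assumes g: "path_gain g" "P > 0" "N > 0" and E: "loc_finite E" "E \<noteq> {}"
  shows "(SUP e\<in>E. capacity g P N x e) < c \<longleftrightarrow> (\<forall>e\<in>E. capacity g P N x e < c)"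
proof -
  let ?C = "capacity g P N x"
  have "\<exists>e0\<in>E. \<forall>e\<in>E. ?C e \<le> ?C e0"
  proof (cases "E = {x}")
    case False
    then have "loc_finite (E - {x})" "E - {x} \<noteq> {}"
      using E by (auto intro: loc_finite_subset)
    then obtain e1 where e1: "e1 \<in> E" "e1 \<noteq> x" "\<And>e. e \<in> E - {x} \<Longrightarrow> dist x e1 \<le> dist x e"
      using loc_finite_ex_nearest[of "E - {x}" x] by blast
    have e_le: "?C e \<le> ?C e1" if "e \<in> E - {x}" for e
      using capacity_less_iff[OF g, of x e e1] e1(2) e1(3)[OF that] that
      by (metis DiffD2 insertI1 not_less)
    then have le: "?C e \<le> max (?C e1) (?C x)" if "e \<in> E" for e
      using that by (cases "e = x") (auto simp: le_max_iff_disj)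
    show ?thesis
    proof (cases "x \<in> E \<and> ?C e1 \<le> ?C x")
      case True
      then show ?thesis
        using le by (intro bexI[of _ x]) (auto simp: max_def)
    next
      case False
      have "?C e \<le> ?C e1" if "e \<in> E" for e
        using False le[OF that] e_le that by (cases "e = x") auto
      then show ?thesis
        using e1 by blast
    qed
  qed simp
  then obtain e0 where e0: "e0 \<in> E" "\<And>e. e \<in> E \<Longrightarrow> ?C e \<le> ?C e0"
    by blast
  then have "(SUP e\<in>E. ?C e) = ?C e0"
    by (intro cSup_eq_maximum) auto
  with e0 show ?thesis
    by (auto intro: le_less_trans)
qed

text \<open>The threshold \<open>c\<close> serves two degenerate cases: \<open>Sup {}\<close> when
  there is no eavesdropper, and \<open>capacity g P N x x\<close> when one sits at
  \<open>x\<close>.\<close>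

definition beats :: "(real \<Rightarrow> real) \<Rightarrow> real \<Rightarrow> real \<Rightarrow> 'a::metric_space \<Rightarrow> real \<Rightarrow> 'a set" where
  "beats g P N x c = {y. y \<noteq> x \<and> c < capacity g P N x y}"

text \<open>The cases in which \<^term>\<open>E\<close> is empty or contains \<^term>\<open>x\<close> have probability 0, but the
  probability space need not be complete, so the event must be shown measurable there as well.\<close>

lemma secrecy_graph_out_neighbours:
  assumes g: "path_gain g" "P > 0" "N > 0" and E: "loc_finite E"
  shows "secrecy_graph g P N (insert x L) E `` {x} =
    nearer x (L \<inter> (if E = {} then beats g P N x (Sup {})
                   else if x \<in> E then beats g P N x (capacity g P N x x) else - {x})) E"
proof -
  let ?C = "capacity g P N x"
  have eq: "secrecy_graph g P N (insert x L) E `` {x} = {y\<in>L. y \<noteq> x \<and> (SUP e\<in>E. ?C e) < ?C y}"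
    by (auto simp: secrecy_graph_def secrecy_rate_def)
  show ?thesis
  proof (cases "E = {}")
    case True
    \<comment> \<open>\<open>nearer\<close> imposes no condition when \<open>E\<close> is empty, and
      the supremum is the constant \<open>Sup {}\<close>.\<close>
    then show ?thesis
      unfolding eq by (auto simp: nearer_def beats_def)
  next
    case False
    have "?C e < ?C y \<longleftrightarrow> dist x y < dist x e" if "y \<noteq> x" "e \<noteq> x" for y e
      using capacity_less_iff[OF g, of x y e] that by simp
    \<comment> \<open>An eavesdropper at \<open>x\<close> is split off because capacities translate
      into distances only when both distances are positive.\<close>
    then have "(\<forall>e\<in>E. ?C e < ?C y) \<longleftrightarrow>
        (x \<in> E \<longrightarrow> ?C x < ?C y) \<and> (\<forall>e\<in>E - {x}. dist x y < dist x e)" if "y \<noteq> x" for y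
      using that by (metis Diff_iff singletonD singletonI)
    then have "{y\<in>L. y \<noteq> x \<and> (\<forall>e\<in>E. ?C e < ?C y)} =
        {y\<in>L. y \<noteq> x \<and> (x \<in> E \<longrightarrow> ?C x < ?C y) \<and> (\<forall>e\<in>E - {x}. dist x y < dist x e)}"
      by (intro Collect_cong conj_cong refl)
    also have "\<dots> =
        nearer x (L \<inter> (if x \<in> E then beats g P N x (?C x) else - {x})) E"
      unfolding nearer_def beats_def by (cases "x \<in> E") auto
    finally show ?thesis
      unfolding eq Sup_capacity_less_iff[OF g E False] using False by simp
  qed
qed

text \<open>\<open>g\<close> is not assumed measurable, but monotonicity makes it Borel on the
  positive reals. Its value at 0 is uncontrolled, so the argument lives on the space punctured at
  \<open>x\<close>.\<close>

lemma beats_borel: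
  fixes x :: "'a::euclidean_space"
  assumes "path_gain g"
  shows "beats g P N x c \<in> sets borel"
proof -
  have "mono_on {0<..} (\<lambda>r. - g r)"
    using assms by (auto simp: path_gain_def monotone_on_def le_less)
  then have "(\<lambda>r. - g r) \<in> borel_measurable (restrict_space borel {0<..})"
    by (rule borel_measurable_mono_on_fnc)
  then have g: "g \<in> borel_measurable (restrict_space borel {0<..})"
    by simp
  have "(\<lambda>y. dist x y) \<in> restrict_space borel (- {x}) \<rightarrow>\<^sub>M restrict_space borel {0<..}"
    by (intro measurable_restrict_space3 borel_measurable_dist) auto
  from measurable_compose[OF this g]
  have [measurable]: "(\<lambda>y. g (dist x y)) \<in> borel_measurable (restrict_space borel (- {x}))" .
  have "{y \<in> space (restrict_space borel (- {x})). c < capacity g P N x y}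
      \<in> sets (restrict_space borel (- {x}))"
    unfolding capacity_def by measurable
  moreover have "{y \<in> space (restrict_space borel (- {x})). c < capacity g P N x y} = beats g P N x c"
    by (auto simp: beats_def space_restrict_space)
  ultimately show ?thesis
    by (simp add: sets_restrict_space_iff)
qed

text \<open>In each of the three cases of \<open>secrecy_graph_out_neighbours\<close> the legitimate
  points are restricted to a Borel set that does not depend on \<open>\<omega>\<close>, so
  \<open>sets_nearer_card\<close> applies to the restricted configuration.\<close>

lemma sets_secrecy_out_degree:
  fixes X Y :: "'w \<Rightarrow> 'a::euclidean_space set"
  assumes X: "X \<in> M \<rightarrow>\<^sub>M config_space" and Y: "Y \<in> M \<rightarrow>\<^sub>M config_space"
    and g: "path_gain g" "P > 0" "N > 0"
  shows "{\<omega>\<in>space M. out_degree (secrecy_graph g P N (insert x (X \<omega>)) (Y \<omega>)) x = enat n} \<in> sets M"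
proof -
  define Q where "Q B \<omega> \<longleftrightarrow> finite (nearer x (X \<omega> \<inter> B) (Y \<omega>)) \<and>
    card (nearer x (X \<omega> \<inter> B) (Y \<omega>)) = n" for B \<omega>
  have Q: "{\<omega>\<in>space M. Q B \<omega>} \<in> sets M" if "B \<in> sets borel" for B
    unfolding Q_def by (intro sets_nearer_card measurable_config_Int X Y that)
  have Q_beats: "{\<omega>\<in>space M. Q (beats g P N x c) \<omega>} \<in> sets M" for c
    by (rule Q[OF beats_borel[OF g(1)]])
  have Q_punctured: "{\<omega>\<in>space M. Q (- {x}) \<omega>} \<in> sets M"
    by (rule Q) simp
  have Y_empty: "{\<omega>\<in>space M. Y \<omega> = {}} \<in> sets M"
    by (rule sets_config_empty[OF Y])
  have lf: "loc_finite (Y \<omega>)" if "\<omega> \<in> space M" for \<omega>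
    using measurable_space[OF Y that] by (simp add: space_config_space)
  have "{\<omega>\<in>space M. x \<in> Y \<omega>} = {\<omega>\<in>space M. card (Y \<omega> \<inter> {x}) = 1}"
    by (auto simp: Int_insert_right)
  also have "\<dots> \<in> sets M"
    using Y by (simp add: measurable_config_space_iff)
  finally have Y_x: "{\<omega>\<in>space M. x \<in> Y \<omega>} \<in> sets M" .
  have "{\<omega>\<in>space M. out_degree (secrecy_graph g P N (insert x (X \<omega>)) (Y \<omega>)) x = enat n} =
    {\<omega>\<in>space M. (Y \<omega> = {} \<and> Q (beats g P N x (Sup {})) \<omega>) \<or>
      (x \<in> Y \<omega> \<and> Q (beats g P N x (capacity g P N x x)) \<omega>) \<or>
      (\<not> (Y \<omega> = {} \<or> x \<in> Y \<omega>) \<and> Q (- {x}) \<omega>)}"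
  proof (intro Collect_cong conj_cong refl)
    fix \<omega> assume "\<omega> \<in> space M"
    note eq = secrecy_graph_out_neighbours[OF g lf[OF this], of x "X \<omega>"]
    consider "Y \<omega> = {}" | "x \<in> Y \<omega>" | "Y \<omega> \<noteq> {}" "x \<notin> Y \<omega>"
      by blast
    then show "out_degree (secrecy_graph g P N (insert x (X \<omega>)) (Y \<omega>)) x = enat n \<longleftrightarrow>
        (Y \<omega> = {} \<and> Q (beats g P N x (Sup {})) \<omega>) \<or>
        (x \<in> Y \<omega> \<and> Q (beats g P N x (capacity g P N x x)) \<omega>) \<or>
        (\<not> (Y \<omega> = {} \<or> x \<in> Y \<omega>) \<and> Q (- {x}) \<omega>)"
      unfolding out_degree_eq_iff eq Q_def by cases auto
  qed
  also have "\<dots> \<in> sets M"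
    by (intro sets.sets_Collect_disj sets.sets_Collect_conj sets.sets_Collect_neg
        Q_beats Q_punctured Y_empty Y_x)
  finally show ?thesis .
qed

theorem theorem3p2:
  fixes M :: "'w measure"
    and \<Phi>\<^sub>l \<Phi>\<^sub>e :: "'w \<Rightarrow> (real ^ 2) set"
    and d\<^sub>l d\<^sub>e P N :: real
    and g :: "real \<Rightarrow> real"
  assumes "d\<^sub>l > 0" "d\<^sub>e > 0"
    and "poisson_process M d\<^sub>l \<Phi>\<^sub>l"
    and "poisson_process M d\<^sub>e \<Phi>\<^sub>e"
    and "prob_space.indep_var M config_space \<Phi>\<^sub>l config_space \<Phi>\<^sub>e"
    and "path_gain g" "P > 0" "N > 0"
  shows "\<forall>n::nat.
    measure M {\<omega> \<in> space M.
        out_degree (secrecy_graph g P N (insert 0 (\<Phi>\<^sub>l \<omega>)) (\<Phi>\<^sub>e \<omega>)) 0 = enat n} =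
      (d\<^sub>l / (d\<^sub>l + d\<^sub>e)) ^ n * (d\<^sub>e / (d\<^sub>l + d\<^sub>e))"
proof
  fix n :: nat
  interpret prob_space M
    using assms(3) by (simp add: poisson_process_def)
  have L: "\<Phi>\<^sub>l \<in> M \<rightarrow>\<^sub>M config_space" and E: "\<Phi>\<^sub>e \<in> M \<rightarrow>\<^sub>M config_space"
    using assms(3,4) by (auto simp: poisson_process_def)
  have "measure M {\<omega> \<in> space M.
        out_degree (secrecy_graph g P N (insert 0 (\<Phi>\<^sub>l \<omega>)) (\<Phi>\<^sub>e \<omega>)) 0 = enat n} =
      measure M {\<omega> \<in> space M. finite (nearer 0 (\<Phi>\<^sub>l \<omega>) (\<Phi>\<^sub>e \<omega>)) \<and>
        card (nearer 0 (\<Phi>\<^sub>l \<omega>) (\<Phi>\<^sub>e \<omega>)) = n}"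
  \<comment> \<open>Almost surely there is an eavesdropper, and neither an eavesdropper nor a
    legitimate point sits at the origin; then the out-neighbours are exactly the points of
    \<open>nearer\<close>.\<close>
  proof (rule finite_measure_eq_AE)
    show "AE \<omega> in M. \<omega> \<in> {\<omega> \<in> space M.
        out_degree (secrecy_graph g P N (insert 0 (\<Phi>\<^sub>l \<omega>)) (\<Phi>\<^sub>e \<omega>)) 0 = enat n} \<longleftrightarrow>
      \<omega> \<in> {\<omega> \<in> space M. finite (nearer 0 (\<Phi>\<^sub>l \<omega>) (\<Phi>\<^sub>e \<omega>)) \<and>
        card (nearer 0 (\<Phi>\<^sub>l \<omega>) (\<Phi>\<^sub>e \<omega>)) = n}"
      using poisson_process_AE_nonempty[OF assms(4,2)] poisson_process_AE_notin[OF assms(4), of 0]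
        poisson_process_AE_notin[OF assms(3), of 0] AE_space
    proof eventually_elim
      case (elim \<omega>)
      have "loc_finite (\<Phi>\<^sub>e \<omega>)"
        using measurable_space[OF E] elim by (simp add: space_config_space)
      \<comment> \<open>\<open>nearer\<close> would count a legitimate point at the origin, which a
        graph without loops does not.\<close>
      moreover have "\<Phi>\<^sub>l \<omega> \<inter> - {0} = \<Phi>\<^sub>l \<omega>"
        using elim by auto
      ultimately show ?case
        using elim by (simp add: out_degree_eq_iff secrecy_graph_out_neighbours[OF assms(6-8)])
    qed
  qed (intro sets_secrecy_out_degree sets_nearer_card L E assms(6-8))+
  also have "\<dots> = (d\<^sub>l / (d\<^sub>l + d\<^sub>e)) ^ n * (d\<^sub>e / (d\<^sub>l + d\<^sub>e))"
    by (rule poisson_nearer_distribution[OF assms(1-5)])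
  finally show "measure M {\<omega> \<in> space M.
        out_degree (secrecy_graph g P N (insert 0 (\<Phi>\<^sub>l \<omega>)) (\<Phi>\<^sub>e \<omega>)) 0 = enat n} =
      (d\<^sub>l / (d\<^sub>l + d\<^sub>e)) ^ n * (d\<^sub>e / (d\<^sub>l + d\<^sub>e))" .
qed

end
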